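(* Let $(L,\preceq)$ be a meet semilattice with $n$ elements, $L=\{z_1,z_2,\ldots,z_n\}$. Then the following conditions are equivalent: (1) For all real $\alpha>0$ and for all sets $S=\{x_1,x_2,\ldots,x_n\}$ of positive integers such that $(S,\mid)\cong(L,\preceq)$, the $n\times n$ power LCM matrix whose $(i,j)$-entry is $\mathrm{lcm}(x_i,x_j)^\alpha$ is nonsingular. (2) $L$ is a $\wedge$-tree set. (3) For all $z_i,z_j\in L$, $\mu_L(z_i,z_j)>0$ implies $z_i=z_j$.
   Context: $(S,\mid)$ denotes $S$ (with $n$ distinct elements) partially ordered by divisibility, and $\cong$ is isomorphism of posets. A subset of a meet semilattice is a $\wedge$-tree set if the Hasse diagram of its meet closure is a tree when considered as an undirected graph; for a finite meet closed set (such as $L$ itself) this is equivalent to: every element of the set covers at most one element of the set. In a poset, $x$ covers $y$ if $y\prec x$ and there is no $w$ with $y\prec w\prec x$. $\mu_L$ denotes the Möbius function of the finite poset $L$: $\mu_L(u,u)=1$, $\mu_L(u,v)=-\sum_{u\preceq w\prec v}\mu_L(u,w)$ for $u\prec v$, and $\mu_L(u,v)=0$ if $u\not\preceq v$.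
   Formalization: In (1), S is additionally required to be closed under gcd; without this the claim fails: S={1,2,15,42} is a tree-shaped meet semilattice under divisibility, but its LCM matrix (α=1) is singular. *)

theory Defs
  imports
    Complex_Main
    "HOL.Hull"
    "Jordan_Normal_Form.Determinant"
begin

section \<open>Meet closure and Hasse diagrams\<close>

definition meet_closed :: "'a::semilattice_inf set \<Rightarrow> bool" where
  "meet_closed A \<longleftrightarrow> (\<forall>x\<in>A. \<forall>y\<in>A. inf x y \<in> A)"

definition meet_closure :: "'a::semilattice_inf set \<Rightarrow> 'a set" where
  "meet_closure A = meet_closed hull A"

definition covers_in :: "'a::order set \<Rightarrow> 'a \<Rightarrow> 'a \<Rightarrow> bool" where
  "covers_in A x y \<longleftrightarrow> x \<in> A \<and> y \<in> A \<and> y < x \<and> \<not> (\<exists>w\<in>A. y < w \<and> w < x)"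

definition hasse_edges :: "'a::order set \<Rightarrow> 'a set set" where
  "hasse_edges A = {{x, y} | x y. covers_in A x y}"


section \<open>Undirected trees\<close>

text \<open>
  A simple graph is a vertex set together with a set of two-element edges; a
  cycle is the list of its (at least three) distinct vertices.  The constant
  \<open>tree\<close> of the AFP entry \<open>Graph_Theory\<close> is not suitable here: it only
  excludes directed cycles, so the orientation of a Hasse diagram would satisfy
  that condition always and its symmetric closure almost never.
\<close>

definition graph_cycle :: "'a set set \<Rightarrow> 'a list \<Rightarrow> bool" where
  "graph_cycle E c \<longleftrightarrow>
     3 \<le> length c \<and> distinct c \<and>
     (\<forall>i < length c. {c ! i, c ! (Suc i mod length c)} \<in> E)"

definition graph_connected :: "'a set \<Rightarrow> 'a set set \<Rightarrow> bool" where
  "graph_connected V E \<longleftrightarrow>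
     V \<noteq> {} \<and> (\<forall>u\<in>V. \<forall>v\<in>V. (u, v) \<in> {(x, y). {x, y} \<in> E}\<^sup>*)"

definition graph_tree :: "'a set \<Rightarrow> 'a set set \<Rightarrow> bool" where
  "graph_tree V E \<longleftrightarrow> graph_connected V E \<and> \<not> (\<exists>c. graph_cycle E c)"

definition wedge_tree_set :: "'a::semilattice_inf set \<Rightarrow> bool" where
  "wedge_tree_set A \<longleftrightarrow> graph_tree (meet_closure A) (hasse_edges (meet_closure A))"


section \<open>Moebius function of a finite poset\<close>

function moebius :: "'a::{finite, order} \<Rightarrow> 'a \<Rightarrow> int" where
  "moebius u v =
     (if u = v then 1
      else if u < v then - (\<Sum>w\<in>{w. u \<le> w \<and> w < v}. moebius u w)
      else 0)"
  by auto
termination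
proof (relation "measure (\<lambda>(u, v). card {w. w < v})")
  fix u v w :: 'a
  assume "w \<in> {w. u \<le> w \<and> w < v}"
  then have "{t. t < w} \<subset> {t. t < v}" by auto
  then have "card {t. t < w} < card {t. t < v}"
    by (intro psubset_card_mono) simp_all
  then show "((u, w), (u, v)) \<in> measure (\<lambda>(u, v). card {w. w < v})"
    by simp
qed simp

declare moebius.simps [simp del]


section \<open>Isomorphic posets and power LCM matrices\<close>

definition isomorphic_posets ::
  "'a set \<Rightarrow> ('a \<Rightarrow> 'a \<Rightarrow> bool) \<Rightarrow> 'b set \<Rightarrow> ('b \<Rightarrow> 'b \<Rightarrow> bool) \<Rightarrow> bool" where
  "isomorphic_posets A leA B leB \<longleftrightarrow>
     (\<exists>f. bij_betw f A B \<and> (\<forall>x\<in>A. \<forall>y\<in>A. leA x y \<longleftrightarrow> leB (f x) (f y)))"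

text \<open>
  The isomorphism type of \<open>(S, dvd)\<close> alone does not control \<open>gcd (x i) (x j)\<close>, hence
  not \<open>lcm (x i) (x j)\<close> either: the set \<open>{1, 2, 15, 42}\<close> is, as a poset, a meet
  semilattice whose Hasse diagram is a tree, but its LCM matrix (\<open>\<alpha> = 1\<close>) is
  singular; here \<open>gcd 15 42 = 3\<close> while the meet of 15 and 42 within the set is 1.
  So \<open>S\<close> has to be a meet subsemilattice of the positive integers under
  divisibility, whose meet is \<open>gcd\<close>.
\<close>

definition gcd_closed :: "nat set \<Rightarrow> bool" where
  "gcd_closed S \<longleftrightarrow> (\<forall>a\<in>S. \<forall>b\<in>S. gcd a b \<in> S)"

definition power_lcm_matrix :: "real \<Rightarrow> nat \<Rightarrow> (nat \<Rightarrow> nat) \<Rightarrow> real mat" where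
  "power_lcm_matrix \<alpha> n x = mat n n (\<lambda>(i, j). real (lcm (x i) (x j)) powr \<alpha>)"

end

(* The Hasse diagram of a finite meet semilattice is a tree iff all principal ideals are chains; a
   minimal violation v covers two elements c and d, and summing over the ideals of c, d and
   inf c d by inclusion-exclusion gives moebius (inf c d) v > 0. With X the gcd closed set
   indexed by L, the LCM matrix is congruent, up to scaling, to the diagonal matrix of the Moebius
   transform of X powr -alpha. On a tree the entries of the latter are differences of consecutive
   values. At a minimal violation v, for X a product of distinct primes indexed by the ideal, the
   entry at v is negative for small alpha and positive for alpha = 1, hence vanishes in between. *)

theory Submission
  imports Defs "HOL-Computational_Algebra.Primes"
begin

section \<open>Finite orders whose principal ideals are chains\<close>

text \<open>Demanded of every \<open>v\<close>, this amounts in a finite order to each element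
  covering at most one element. The condition at a single \<open>v\<close> is what the minimal
  violation arguments need.\<close>

definition chain_below :: "'a::order \<Rightarrow> bool" where
  "chain_below v \<longleftrightarrow> (\<forall>a\<le>v. \<forall>b\<le>v. a \<le> b \<or> b \<le> a)"

lemma finite_order_induct:
  fixes v :: "'a::{finite, order}"
  assumes "\<And>v. (\<And>w. w < v \<Longrightarrow> P w) \<Longrightarrow> P v"
  shows "P v"
proof (rule ccontr)
  assume "\<not> P v"
  then obtain m where "\<not> P m" "\<And>b. \<not> P b \<Longrightarrow> b \<le> m \<Longrightarrow> m = b"
    using finite_has_minimal[of "{v. \<not> P v}"] by auto
  then show False
    using assms by (metis less_le)
qed

lemma ex_lower_cover:
  fixes u v :: "'a::{finite, order}"
  assumes "u < v"
  obtains c where "u \<le> c" "covers_in UNIV v c"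
proof -
  obtain c where c: "c \<in> {w. u \<le> w \<and> w < v}" "u \<le> c"
      "\<And>b. b \<in> {w. u \<le> w \<and> w < v} \<Longrightarrow> c \<le> b \<Longrightarrow> c = b"
    using finite_has_maximal2[of "{w. u \<le> w \<and> w < v}" u] assms by auto
  have "covers_in UNIV v c"
    unfolding covers_in_def using c by (metis (mono_tags, lifting) UNIV_I less_le mem_Collect_eq order_less_le_trans order.strict_implies_order)
  with c show thesis by (intro that) auto
qed

text \<open>An element strictly below \<open>v\<close> is comparable with \<open>c\<close> and
  cannot lie strictly above it. Sums over the strict ideal of \<open>v\<close> thereby become sums
  over a principal ideal, where Moebius inversion evaluates them.\<close>

lemma lessThan_eq_atMost_cover:
  assumes "chain_below v" "covers_in UNIV v c"
  shows "{..<v} = {..c}"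
  using assms unfolding chain_below_def covers_in_def
  by (auto simp: less_le) (metis antisym_conv2 order.strict_implies_order less_le)

text \<open>Take \<open>v\<close> minimal without the chain property and incomparable
  \<open>a\<close>, \<open>b\<close> below it. If the lower covers found above \<open>a\<close> and
  above \<open>b\<close> coincided, their common ideal would be a chain containing both.\<close>

lemma minimal_non_chain:
  fixes z :: "'a::{finite, order}"
  assumes "\<not> chain_below z"
  obtains v c d :: 'a where "\<And>w. w < v \<Longrightarrow> chain_below w"
    "covers_in UNIV v c" "covers_in UNIV v d" "c \<noteq> d"
proof -
  let ?N = "{v::'a. \<not> chain_below v}"
  have "\<exists>v\<in>?N. \<forall>w\<in>?N. w \<le> v \<longrightarrow> v = w"
    using assms by (intro finite_has_minimal) auto
  then obtain v :: 'a where v: "\<not> chain_below v" and min: "\<And>w. \<not> chain_below w \<Longrightarrow> w \<le> v \<Longrightarrow> v = w"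
    by blast
  obtain a b where ab: "a \<le> v" "b \<le> v" "\<not> a \<le> b" "\<not> b \<le> a"
    using v unfolding chain_below_def by auto
  then have "a < v" "b < v" by (auto simp: less_le)
  obtain c where c: "a \<le> c" "covers_in UNIV v c" using ex_lower_cover[OF \<open>a < v\<close>] .
  obtain d where d: "b \<le> d" "covers_in UNIV v d" using ex_lower_cover[OF \<open>b < v\<close>] .
  have *: "chain_below w" if "w < v" for w
    using min[of w] that by (auto simp: less_le)
  have "chain_below c" using * c(2) by (auto simp: covers_in_def)
  then have "c \<noteq> d" using ab c d unfolding chain_below_def by auto
  with * c(2) d(2) show thesis by (rule that)
qed

lemma covers_in_incomparable:
  assumes "covers_in UNIV v c" "covers_in UNIV v d" "c \<noteq> d"
  shows "\<not> c \<le> d"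
  using assms unfolding covers_in_def by (auto simp: less_le)

lemma inf_less_covers:
  fixes c d :: "'a::semilattice_inf"
  assumes "covers_in UNIV v c" "covers_in UNIV v d" "c \<noteq> d"
  shows "inf c d < c" "inf c d < d"
  using covers_in_incomparable[OF assms] covers_in_incomparable[OF assms(2,1) assms(3)[symmetric]]
  by (auto simp: less_le) (metis inf.cobounded1 inf.cobounded2)+

text \<open>Inclusion-exclusion on the ideals of \<open>c\<close> and \<open>d\<close>, which
  intersect in the ideal of \<open>inf c d\<close>; what remains below \<open>v\<close> contributes
  at most 0. It serves for both the Moebius function and the Moebius transform; the premise
  \<open>\<not> w \<le> c\<close> rules out the exceptional positive terms.\<close>

lemma sum_lessThan_le:
  fixes g :: "'a::{finite, semilattice_inf} \<Rightarrow> 'b::ordered_ab_group_add"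
  assumes "c < v" "d < v" and neg: "\<And>w. w < v \<Longrightarrow> \<not> w \<le> c \<Longrightarrow> g w \<le> 0"
  shows "sum g {..<v} \<le> sum g {..c} + sum g {..d} - sum g {..inf c d}"
proof -
  have sub: "{..c} \<union> {..d} \<subseteq> {..<v}"
    using assms by (auto intro: order_le_less_trans)
  have "sum g {..<v} = sum g ({..<v} - ({..c} \<union> {..d})) + sum g ({..c} \<union> {..d})"
    using sub by (intro sum.subset_diff) auto
  also have "sum g ({..<v} - ({..c} \<union> {..d})) \<le> 0"
    by (intro sum_nonpos neg) auto
  also have "sum g ({..c} \<union> {..d}) = sum g {..c} + sum g {..d} - sum g ({..c} \<inter> {..d})"
    by (intro sum_Un) auto
  also have "{..c} \<inter> {..d} = {..inf c d}" by auto
  finally show ?thesis by simp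
qed

section \<open>Hasse diagrams that are trees\<close>

lemma hasse_edge_iff:
  "{x, y} \<in> hasse_edges A \<longleftrightarrow> covers_in A x y \<or> covers_in A y x"
  unfolding hasse_edges_def by (auto simp: doubleton_eq_iff)

section \<open>Simple paths and cycles in undirected graphs\<close>

lemma rtrancl_simple_path:
  assumes "(x, y) \<in> R\<^sup>*"
  shows "\<exists>p. p \<noteq> [] \<and> hd p = x \<and> last p = y \<and> distinct p \<and>
           (\<forall>i. Suc i < length p \<longrightarrow> (p ! i, p ! Suc i) \<in> R)"
  using assms
proof (induction rule: rtrancl_induct)
  case base
  show ?case by (intro exI[of _ "[x]"]) simp
next
  case (step y z)
  then obtain p where p: "p \<noteq> []" "hd p = x" "last p = y" "distinct p"
    "\<forall>i. Suc i < length p \<longrightarrow> (p ! i, p ! Suc i) \<in> R" by blast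
  show ?case
  proof (cases "z \<in> set p")
    \<comment> \<open>When the walk returns to a vertex of \<open>p\<close>, the path is cut off at
      that vertex.\<close>
    case True
    then obtain k where k: "k < length p" "p ! k = z" by (auto simp: in_set_conv_nth)
    show ?thesis
      using p k by (intro exI[of _ "take (Suc k) p"]) (auto simp: hd_take last_conv_nth)
  next
    case False
    show ?thesis
      using p False step.hyps
      by (intro exI[of _ "p @ [z]"])
        (auto simp: nth_append last_conv_nth less_Suc_eq,
         metis One_nat_def Suc_pred' diff_Suc_1 length_greater_0_conv)
  qed
qed

text \<open>If the ends of an edge stay connected after its removal, a simple path between them
  together with the edge is a cycle. The path has at least three vertices, since one with two would
  be the removed edge.\<close>

lemma graph_cycleI:
  assumes "{x, y} \<in> E" "x \<noteq> y" "(x, y) \<in> {(a, b). {a, b} \<in> E - {{x, y}}}\<^sup>*"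
  shows "\<exists>c. graph_cycle E c"
proof -
  obtain p where p: "p \<noteq> []" "hd p = x" "last p = y" "distinct p"
    and E: "\<And>i. Suc i < length p \<Longrightarrow> {p ! i, p ! Suc i} \<in> E - {{x, y}}"
    using rtrancl_simple_path[OF assms(3)] by blast
  have hd: "p ! 0 = x" and last: "p ! (length p - 1) = y"
    using p by (auto simp: hd_conv_nth last_conv_nth)
  have "length p \<noteq> 0" "length p \<noteq> 1" using p assms(2) hd last by auto
  moreover have "length p \<noteq> 2"
  proof
    assume "length p = 2"
    then show False using E[of 0] hd last by (simp add: numeral_2_eq_2)
  qed
  ultimately have len: "3 \<le> length p" by linarith
  have "{p ! i, p ! (Suc i mod length p)} \<in> E" if "i < length p" for i
  proof (cases "Suc i < length p")
    case True
    then show ?thesis using E[of i] by simp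
  next
    \<comment> \<open>At the last index \<open>Suc i mod length p\<close> is 0, so the closing edge
      is \<open>{x, y}\<close> itself.\<close>
    case False
    then have i: "Suc i = length p" using that by simp
    then have "i = length p - 1" by simp
    then show ?thesis using assms(1) hd last i by (simp add: insert_commute)
  qed
  then show ?thesis unfolding graph_cycle_def using len p by blast
qed

text \<open>Descending along lower covers never leaves the ideal of \<open>c\<close>. This bound
  later keeps such paths away from a larger element \<open>v\<close>.\<close>

lemma cover_path:
  fixes u c :: "'a::{finite, order}"
  assumes "u \<le> c"
  shows "(u, c) \<in> {(x, y). covers_in UNIV y x \<and> y \<le> c}\<^sup>*"
  using assms
proof (induction c rule: finite_order_induct)
  case (1 c)
  show ?case
  proof (cases "u = c")
    case False
    then obtain d where d: "u \<le> d" "covers_in UNIV c d"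
      using ex_lower_cover[of u c] 1 by (auto simp: less_le)
    then have "d < c" by (simp add: covers_in_def)
    then have "(u, d) \<in> {(x, y). covers_in UNIV y x \<and> y \<le> d}\<^sup>*" using 1 d by blast
    then have "(u, d) \<in> {(x, y). covers_in UNIV y x \<and> y \<le> c}\<^sup>*"
      by (rule set_mp[OF rtrancl_mono, rotated]) (use \<open>d < c\<close> in auto)
    then show ?thesis
      by (rule rtrancl_into_rtrancl) (use d in auto)
  qed simp
qed

lemma finite_semilattice_inf_bot:
  obtains b :: "'a::{finite, semilattice_inf}" where "\<And>x. b \<le> x"
proof -
  obtain b :: 'a where b: "\<And>x. x \<le> b \<Longrightarrow> b = x"
    using finite_has_minimal[of "UNIV :: 'a set"] by auto
  have "b \<le> x" for x using b[of "inf b x"] by (metis inf_le1 inf_le2)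
  then show thesis using that by blast
qed

text \<open>If \<open>v\<close> covers \<open>c\<close> and \<open>d\<close>, then descending from
  \<open>c\<close> to \<open>inf c d\<close>, climbing to \<open>d\<close> and stepping to
  \<open>v\<close> connects \<open>c\<close> to \<open>v\<close> without the edge between them,
  which gives a cycle. Conversely, a maximal vertex of a cycle covers both its neighbours there,
  contradicting the chain property; connectedness comes from the bottom element.\<close>

lemma graph_tree_hasse_iff:
  "graph_tree UNIV (hasse_edges (UNIV :: 'a::{finite, semilattice_inf} set)) \<longleftrightarrow> (\<forall>v :: 'a. chain_below v)"
    (is "graph_tree _ ?E \<longleftrightarrow> _")
proof
  assume tree: "graph_tree UNIV ?E"
  show "\<forall>v::'a. chain_below v"
  proof (rule ccontr)
    assume "\<not> ?thesis"
    then obtain z :: 'a where "\<not> chain_below z" by blast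
    then obtain v c d :: 'a where cd: "covers_in UNIV v c" "covers_in UNIV v d" "c \<noteq> d"
      by (rule minimal_non_chain)
    then have less: "c < v" "d < v" by (auto simp: covers_in_def)
    let ?R = "{(a, b). {a, b} \<in> ?E - {{c, v}}}"
    have R: "(a, b) \<in> ?R" if "covers_in UNIV a b \<or> covers_in UNIV b a" "a \<noteq> v" "b \<noteq> v" for a b
      using that by (auto simp: hasse_edge_iff doubleton_eq_iff)
    \<comment> \<open>The path runs inside the ideal of \<open>e\<close>, which does not contain
      \<open>v\<close>, so it avoids the deleted edge.\<close>
    have up: "(inf c d, e) \<in> ?R\<^sup>*" if "inf c d \<le> e" "e < v" for e
    proof -
      have "{(x, y). covers_in UNIV y x \<and> y \<le> e} \<subseteq> ?R"
      proof clarify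
        fix x y assume "covers_in UNIV y x" "y \<le> e"
        moreover from this have "x < y" "y < v" using that(2) by (auto simp: covers_in_def)
        ultimately show "{x, y} \<in> ?E - {{c, v}}" using R[of x y] by auto
      qed
      then show ?thesis using cover_path[OF that(1)] rtrancl_mono by blast
    qed
    have "sym ?R" by (auto simp: sym_def insert_commute)
    then have "(c, inf c d) \<in> ?R\<^sup>*"
      using up[of c] less by (auto dest: sym_rtrancl symD)
    also have "(inf c d, d) \<in> ?R\<^sup>*" using up[of d] less by auto
    also have "(d, v) \<in> ?R" using cd less by (auto simp: hasse_edge_iff doubleton_eq_iff)
    finally have "\<exists>c. graph_cycle ?E c"
      using cd less by (intro graph_cycleI[of c v]) (auto simp: hasse_edge_iff)
    then show False using tree by (simp add: graph_tree_def)
  qed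
next
  assume chain: "\<forall>v::'a. chain_below v"
  let ?R = "{(x, y). {x, y} \<in> ?E}"
  obtain b :: 'a where b: "\<And>x. b \<le> x" using finite_semilattice_inf_bot by blast
  have bx: "(b, x) \<in> ?R\<^sup>*" for x
    by (rule set_mp[OF rtrancl_mono cover_path[OF b[of x]]]) (auto simp: hasse_edge_iff)
  have "sym ?R" by (auto simp: sym_def insert_commute)
  then have "(x, b) \<in> ?R\<^sup>*" for x using bx by (auto dest: sym_rtrancl symD)
  then have "(x, y) \<in> ?R\<^sup>*" for x y using bx by (meson rtrancl_trans)
  then have "graph_connected UNIV ?E" unfolding graph_connected_def by blast
  moreover have False if c: "graph_cycle ?E c" for c
  proof -
    let ?n = "length c"
    have n: "3 \<le> ?n" and dist: "distinct c"
      and E: "\<And>i. i < ?n \<Longrightarrow> {c ! i, c ! (Suc i mod ?n)} \<in> ?E"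
      using c by (auto simp: graph_cycle_def)
    obtain m where m: "m \<in> set c" "\<And>b. b \<in> set c \<Longrightarrow> m \<le> b \<Longrightarrow> m = b"
      using finite_has_maximal[of "set c"] n by fastforce
    obtain i where i: "i < ?n" "c ! i = m" using m(1) by (auto simp: in_set_conv_nth)
    define j where "j = (if i = 0 then ?n - 1 else i - 1)"
    define k where "k = Suc i mod ?n"
    have j: "j < ?n" "Suc j mod ?n = i" using i n by (auto simp: j_def)
    have k: "k < ?n" unfolding k_def using n by (intro mod_less_divisor) linarith
    \<comment> \<open>Predecessor and successor of position \<open>i\<close> differ because the
      cycle has at least three vertices.\<close>
    have "j \<noteq> k"
      using i n by (cases "Suc i = ?n") (auto simp: j_def k_def split: if_splits)
    then have "c ! j \<noteq> c ! k" using dist j k by (simp add: nth_eq_iff_index_eq)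
    have below: "covers_in UNIV m (c ! l)" if "l < ?n" "{m, c ! l} \<in> ?E" for l
    proof -
      have "\<not> covers_in UNIV (c ! l) m"
        using m(2)[of "c ! l"] that(1) by (auto simp: covers_in_def less_le)
      then show ?thesis using that(2) by (auto simp: hasse_edge_iff)
    qed
    have "covers_in UNIV m (c ! j)" using E[of j] j i by (intro below) (auto simp: insert_commute)
    moreover have "covers_in UNIV m (c ! k)" using E[of i] i k by (intro below) (auto simp: k_def)
    ultimately have "{..c ! j} = {..c ! k}"
      using chain lessThan_eq_atMost_cover by metis
    then show False using \<open>c ! j \<noteq> c ! k\<close> by simp
  qed
  ultimately show "graph_tree UNIV ?E" unfolding graph_tree_def by blast
qed

lemma wedge_tree_set_UNIV_iff:
  "wedge_tree_set (UNIV :: 'a::{finite, semilattice_inf} set) \<longleftrightarrow> (\<forall>v::'a. chain_below v)"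
proof -
  have "meet_closure (UNIV :: 'a set) = UNIV"
    unfolding meet_closure_def by (simp add: hull_def top.extremum_unique)
  then show ?thesis by (simp add: wedge_tree_set_def graph_tree_hasse_iff)
qed

section \<open>The Moebius function\<close>

lemma moebius_eq_0: "\<not> u \<le> v \<Longrightarrow> moebius u v = 0"
  by (subst moebius.simps) auto

lemma sum_atMost_moebius:
  fixes u v :: "'a::{finite, order}"
  shows "(\<Sum>w\<in>{..v}. moebius u w) = of_bool (u = v)"
proof -
  have split: "(\<Sum>w\<in>{..v}. moebius u w) = moebius u v + (\<Sum>w\<in>{..<v}. moebius u w)"
  proof -
    have "{..v} = insert v {..<v}" by auto
    then show ?thesis by simp
  qed
  \<comment> \<open>The default value 0 outside the order relation lets the interval of the
    recursion grow to the whole strict ideal.\<close>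
  have restrict: "(\<Sum>w\<in>{..<v}. moebius u w) = (\<Sum>w\<in>{w. u \<le> w \<and> w < v}. moebius u w)"
    by (intro sum.mono_neutral_right) (auto, metis moebius_eq_0)
  show ?thesis
  proof (cases "u < v")
    case True
    then have "moebius u v = - (\<Sum>w\<in>{w. u \<le> w \<and> w < v}. moebius u w)"
      by (subst moebius.simps) auto
    then show ?thesis using split restrict True by simp
  next
    case False
    then have "{w. u \<le> w \<and> w < v} = {}" by auto
    then have "(\<Sum>w\<in>{..<v}. moebius u w) = 0" unfolding restrict by (simp only: sum.empty)
    moreover have "moebius u v = of_bool (u = v)" using False by (subst moebius.simps) auto
    ultimately show ?thesis using split by simp
  qed
qed

lemma moebius_eq_diff:
  fixes u v :: "'a::{finite, order}"
  shows "moebius u v = of_bool (u = v) - (\<Sum>w\<in>{..<v}. moebius u w)"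
proof -
  have "{..v} = insert v {..<v}" by auto
  then show ?thesis using sum_atMost_moebius[of u v] by simp
qed

text \<open>If \<open>v\<close> covers \<open>c\<close>, the strict ideal of \<open>v\<close> is the
  ideal of \<open>c\<close>, so the recursion gives
  \<open>moebius u v = - of_bool (u = c)\<close>.\<close>

lemma moebius_nonpos_chain:
  fixes u v :: "'a::{finite, order}"
  assumes "chain_below v" "u \<noteq> v"
  shows "moebius u v \<le> 0"
proof (cases "u < v")
  case True
  then obtain c where "covers_in UNIV v c" using ex_lower_cover by blast
  then show ?thesis
    using moebius_eq_diff[of u v] lessThan_eq_atMost_cover[OF assms(1)] sum_atMost_moebius[of u c] assms(2)
    by simp
next
  case False
  then show ?thesis using moebius_eq_0[of u v] assms(2) by auto
qed

lemma chain_below_iff_moebius: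
  "(\<forall>v :: 'a::{finite, semilattice_inf}. chain_below v) \<longleftrightarrow>
     (\<forall>z z' :: 'a. moebius z z' > 0 \<longrightarrow> z = z')"
proof
  assume "\<forall>v :: 'a. chain_below v"
  then show "\<forall>z z' :: 'a. moebius z z' > 0 \<longrightarrow> z = z'"
    using moebius_nonpos_chain by (metis not_less)
next
  assume *: "\<forall>z z' :: 'a. moebius z z' > 0 \<longrightarrow> z = z'"
  show "\<forall>v :: 'a. chain_below v"
  proof (rule ccontr)
    assume "\<not> ?thesis"
    then obtain z :: 'a where "\<not> chain_below z" by blast
    then obtain v c d :: 'a where below: "\<And>w. w < v \<Longrightarrow> chain_below w"
      and cd: "covers_in UNIV v c" "covers_in UNIV v d" "c \<noteq> d"
      by (rule minimal_non_chain) blast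
    then have less: "c < v" "d < v" by (auto simp: covers_in_def)
    define u where "u = inf c d"
    have u: "u < c" "u < d" unfolding u_def using cd by (rule inf_less_covers)+
    \<comment> \<open>The three ideal sums are 0, 0 and 1, as \<open>u\<close> is strictly below
      \<open>c\<close> and \<open>d\<close>. Any \<open>w\<close> not below \<open>c\<close> differs
      from \<open>u\<close>, so its Moebius value is nonpositive.\<close>
    have "sum (moebius u) {..<v} \<le> sum (moebius u) {..c} + sum (moebius u) {..d} - sum (moebius u) {..inf c d}"
      using less u by (intro sum_lessThan_le moebius_nonpos_chain below) auto
    then have "sum (moebius u) {..<v} \<le> -1"
      using u less_imp_neq[OF u(1)] less_imp_neq[OF u(2)]
      by (simp add: sum_atMost_moebius u_def[symmetric])
    then have "moebius u v > 0" using moebius_eq_diff[of u v] u less by auto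
    then show False using * u less by (metis less_asym)
  qed
qed

section \<open>Moebius inversion over principal ideals\<close>

definition moebius_transform :: "('a::{finite, order} \<Rightarrow> real) \<Rightarrow> 'a \<Rightarrow> real" where
  "moebius_transform f v = (\<Sum>u\<in>UNIV. real_of_int (moebius u v) * f u)"

lemma sum_atMost_moebius_transform:
  fixes v :: "'a::{finite, order}"
  shows "(\<Sum>w\<in>{..v}. moebius_transform f w) = f v"
proof -
  have "(\<Sum>w\<in>{..v}. moebius_transform f w) = (\<Sum>u\<in>UNIV. \<Sum>w\<in>{..v}. real_of_int (moebius u w) * f u)"
    unfolding moebius_transform_def by (rule sum.swap)
  also have "\<dots> = (\<Sum>u\<in>UNIV. real_of_int (\<Sum>w\<in>{..v}. moebius u w) * f u)"
    by (simp add: sum_distrib_right)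
  also have "\<dots> = (\<Sum>u\<in>UNIV. if u = v then f u else 0)"
    unfolding sum_atMost_moebius by (intro sum.cong) auto
  finally show ?thesis by simp
qed

lemma moebius_transform_eq_diff:
  fixes v :: "'a::{finite, order}"
  shows "moebius_transform f v = f v - sum (moebius_transform f) {..<v}"
proof -
  have "{..v} = insert v {..<v}" by auto
  then show ?thesis using sum_atMost_moebius_transform[of f v] by simp
qed

text \<open>The transform has ideal sums \<open>f\<close>, and the strict ideal of \<open>v\<close>
  is the ideal of \<open>c\<close>, so all but two values telescope away.\<close>

lemma moebius_transform_cover:
  fixes v :: "'a::{finite, order}"
  assumes "chain_below v" "covers_in UNIV v c"
  shows "moebius_transform f v = f v - f c"
  using moebius_transform_eq_diff[of f v] lessThan_eq_atMost_cover[OF assms]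
  by (simp add: sum_atMost_moebius_transform)

text \<open>The uniqueness half of Moebius inversion: recognising a function as ideal sums of
  \<open>h\<close> yields its transform without computing any Moebius values.\<close>

lemma moebius_transform_sum_atMost:
  fixes v :: "'a::{finite, order}"
  shows "moebius_transform (\<lambda>u. \<Sum>w\<in>{..u}. h w) v = h v"
proof (induction v rule: finite_order_induct)
  case (1 v)
  have "{..v} = insert v {..<v}" by auto
  moreover have "sum (moebius_transform (\<lambda>u. \<Sum>w\<in>{..u}. h w)) {..<v} = sum h {..<v}"
    using 1 by (intro sum.cong) auto
  ultimately show ?case using moebius_transform_eq_diff[of "\<lambda>u. \<Sum>w\<in>{..u}. h w" v] by simp
qed

section \<open>Power LCM matrices of meet subsemilattices\<close>

lemma det_diagonal_mat:
  "det (mat n n (\<lambda>(i, j). if i = j then d i else 0)) = (\<Prod>i<n. d i)"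
  by (subst det_upper_triangular[of _ n])
    (auto simp: upper_triangular_def diag_mat_def prod.list_conv_set_nth atLeast0LessThan)

lemma index_mult_mat_sum:
  assumes "A \<in> carrier_mat m n" "B \<in> carrier_mat n l" "i < m" "j < l"
  shows "(A * B) $$ (i, j) = (\<Sum>k\<in>{0..<n}. A $$ (i, k) * B $$ (k, j))"
  using assms by (simp add: scalar_prod_def)

text \<open>As lcm times gcd is the product, the entries are those of
  \<open>X powr - \<alpha>\<close> at meets, with rows and columns scaled by \<open>D\<close>. The
  value at \<open>inf a b\<close> sums the transform over the common lower bounds of
  \<open>a\<close> and \<open>b\<close>, which is the factorisation \<open>Z * G * Z\<^sup>T\<close>
  with the zeta matrix \<open>Z\<close>.\<close>

lemma det_power_lcm_matrix:
  fixes X :: "'a::{finite, semilattice_inf} \<Rightarrow> nat"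
  assumes pos: "\<And>a. 0 < X a" and gcd: "\<And>a b. gcd (X a) (X b) = X (inf a b)"
    and e: "bij_betw e {..<n} (UNIV :: 'a set)"
  shows "det (power_lcm_matrix \<alpha> n (\<lambda>i. X (e i))) = 0 \<longleftrightarrow>
    (\<exists>v. moebius_transform (\<lambda>a. real (X a) powr - \<alpha>) v = 0)"
proof -
  let ?f = "\<lambda>a. real (X a) powr - \<alpha>"
  let ?g = "moebius_transform ?f"
  define D where "D = mat n n (\<lambda>(i, j). if i = j then real (X (e i)) powr \<alpha> else 0)"
  define G where "G = mat n n (\<lambda>(i, j). if i = j then ?g (e i) else 0)"
  define Z where "Z = mat n n (\<lambda>(i, j). of_bool (e j \<le> e i) :: real)"
  define N where "N = mat n n (\<lambda>(i, j). real_of_int (moebius (e j) (e i)))"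
  have carrier: "D \<in> carrier_mat n n" "G \<in> carrier_mat n n" "Z \<in> carrier_mat n n" "N \<in> carrier_mat n n"
    by (auto simp: D_def G_def Z_def N_def)
  have reindex: "(\<Sum>k\<in>{0..<n}. h (e k)) = (\<Sum>a\<in>UNIV. h a)" for h :: "'a \<Rightarrow> real"
    using sum.reindex_bij_betw[OF e, of h] by (simp add: atLeast0LessThan)
  have inj: "e i = e j \<longleftrightarrow> i = j" if "i < n" "j < n" for i j
    using e that by (auto simp: bij_betw_def inj_on_def)
  \<comment> \<open>The enumeration \<open>e\<close> is arbitrary, so \<open>Z\<close> need not be
    triangular; the Moebius matrix \<open>N\<close> serves as an explicit inverse.\<close>
  have "Z * N = 1\<^sub>m n"
  proof (rule eq_matI)
    fix i j assume ij: "i < dim_row (1\<^sub>m n :: real mat)" "j < dim_col (1\<^sub>m n :: real mat)"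
    then have "(Z * N) $$ (i, j) = (\<Sum>k\<in>{0..<n}. of_bool (e k \<le> e i) * real_of_int (moebius (e j) (e k)))"
      by (simp add: Z_def N_def scalar_prod_def)
    also have "\<dots> = (\<Sum>a\<in>UNIV. of_bool (a \<le> e i) * real_of_int (moebius (e j) a))"
      by (rule reindex)
    also have "\<dots> = (\<Sum>a\<in>{..e i}. real_of_int (moebius (e j) a))"
      by (intro sum.mono_neutral_cong_right) auto
    also have "\<dots> = real_of_int (\<Sum>a\<in>{..e i}. moebius (e j) a)" by simp
    also have "\<dots> = 1\<^sub>m n $$ (i, j)" 
      unfolding sum_atMost_moebius using ij inj by auto
    finally show "(Z * N) $$ (i, j) = 1\<^sub>m n $$ (i, j)" .
  qed (auto simp: Z_def N_def)
  then have "det Z * det N = 1" using carrier det_mult[of Z n N] by simp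
  then have Z0: "det Z \<noteq> 0" by auto
  have ZGZ: "(Z * G * Z\<^sup>T) $$ (i, j) = ?f (inf (e i) (e j))" if ij: "i < n" "j < n" for i j
  proof -
    have ZG: "(Z * G) $$ (i, k) = of_bool (e k \<le> e i) * ?g (e k)" if "k < n" for k
      using ij that by (simp add: Z_def G_def scalar_prod_def if_distrib cong: if_cong)
    have "(Z * G * Z\<^sup>T) $$ (i, j) = (\<Sum>k\<in>{0..<n}. (Z * G) $$ (i, k) * Z\<^sup>T $$ (k, j))"
      using ij carrier by (intro index_mult_mat_sum[of _ n]) auto
    also have "\<dots> = (\<Sum>k\<in>{0..<n}. of_bool (e k \<le> e i) * ?g (e k) * of_bool (e k \<le> e j))"
      using ij carrier by (intro sum.cong refl) (subst ZG, auto simp: Z_def)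
    also have "\<dots> = (\<Sum>a\<in>UNIV. of_bool (a \<le> e i) * ?g a * of_bool (a \<le> e j))"
      by (rule reindex)
    also have "\<dots> = (\<Sum>a\<in>{..inf (e i) (e j)}. ?g a)"
      by (intro sum.mono_neutral_cong_right) auto
    finally show ?thesis by (simp add: sum_atMost_moebius_transform)
  qed
  have lcm: "real (lcm (X a) (X b)) powr \<alpha> = real (X a) powr \<alpha> * ?f (inf a b) * real (X b) powr \<alpha>" for a b
  proof -
    have "real (lcm (X a) (X b)) * real (X (inf a b)) = real (X a) * real (X b)"
      using gcd[of a b] prod_gcd_lcm_nat[of "X a" "X b"] by (metis mult.commute of_nat_mult)
    then have "real (lcm (X a) (X b)) = real (X a) * real (X b) / real (X (inf a b))"
      using pos[of "inf a b"] by (simp add: field_simps)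
    then show ?thesis by (simp add: powr_mult powr_divide powr_minus field_simps)
  qed
  let ?M = "Z * G * Z\<^sup>T"
  have M: "?M \<in> carrier_mat n n" using carrier by auto
  have DM: "(D * ?M) $$ (i, k) = real (X (e i)) powr \<alpha> * ?M $$ (i, k)" if "i < n" "k < n" for i k
  proof -
    have "(D * ?M) $$ (i, k) = (\<Sum>l\<in>{0..<n}. D $$ (i, l) * ?M $$ (l, k))"
      using that carrier M by (intro index_mult_mat_sum)
    also have "\<dots> = (\<Sum>l\<in>{0..<n}. if l = i then real (X (e i)) powr \<alpha> * ?M $$ (l, k) else 0)"
      using that by (intro sum.cong) (auto simp: D_def)
    finally show ?thesis using that by simp
  qed
  have "power_lcm_matrix \<alpha> n (\<lambda>i. X (e i)) = D * ?M * D"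
  proof (rule eq_matI)
    fix i j assume "i < dim_row (D * ?M * D)" "j < dim_col (D * ?M * D)"
    then have ij: "i < n" "j < n" using carrier by auto
    have "(D * ?M * D) $$ (i, j) = (\<Sum>k\<in>{0..<n}. (D * ?M) $$ (i, k) * D $$ (k, j))"
      using ij carrier M by (intro index_mult_mat_sum[of _ n]) auto
    also have "\<dots> = (\<Sum>k\<in>{0..<n}. if k = j then (D * ?M) $$ (i, k) * real (X (e j)) powr \<alpha> else 0)"
      using ij by (intro sum.cong) (auto simp: D_def)
    also have "\<dots> = real (X (e i)) powr \<alpha> * ?M $$ (i, j) * real (X (e j)) powr \<alpha>"
      using ij by (simp add: DM)
    also have "\<dots> = power_lcm_matrix \<alpha> n (\<lambda>i. X (e i)) $$ (i, j)"
      using ij by (simp add: ZGZ lcm power_lcm_matrix_def del: index_mult_mat(1))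
    finally show "power_lcm_matrix \<alpha> n (\<lambda>i. X (e i)) $$ (i, j) = (D * ?M * D) $$ (i, j)" by simp
  qed (use carrier in \<open>auto simp: power_lcm_matrix_def\<close>)
  then have "det (power_lcm_matrix \<alpha> n (\<lambda>i. X (e i))) = (det D)\<^sup>2 * (det Z)\<^sup>2 * det G"
    using carrier M by (simp add: det_mult[of _ n] det_transpose[of _ n] power2_eq_square)
  moreover have "det D \<noteq> 0"
    unfolding D_def det_diagonal_mat using pos by (simp add: less_imp_neq[symmetric])
  moreover have "det G = 0 \<longleftrightarrow> (\<exists>v. ?g v = 0)"
  proof -
    have "det G = 0 \<longleftrightarrow> (\<exists>v\<in>e ` {..<n}. ?g v = 0)"
      unfolding G_def det_diagonal_mat by auto
    then show ?thesis using e by (metis UNIV_I bij_betw_imp_surj_on)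
  qed
  ultimately show ?thesis using Z0 by simp
qed

text \<open>At a non-minimal \<open>v\<close> the transform is the negative difference
  \<open>f v - f c\<close> for a lower cover \<open>c\<close>; at a minimal \<open>v\<close> it is
  \<open>f v\<close>.\<close>

lemma moebius_transform_neq_0:
  fixes f :: "'a::{finite, order} \<Rightarrow> real"
  assumes "chain_below v" "\<And>a b. a < b \<Longrightarrow> f b < f a" "\<And>a. 0 < f a"
  shows "moebius_transform f v \<noteq> 0"
proof (cases "\<exists>u. u < v")
  case True
  then obtain c where c: "covers_in UNIV v c" using ex_lower_cover by blast
  then show ?thesis
    using moebius_transform_cover[OF assms(1) c, of f] assms(2)[of c v] by (auto simp: covers_in_def)
next
  case False
  then have "{..<v} = {}" by auto
  then show ?thesis using moebius_transform_eq_diff[of f v] assms(3)[of v] by simp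
qed

lemma power_lcm_matrix_nonsingular:
  fixes S :: "nat set"
  assumes chain: "\<And>v :: 'a::{finite, semilattice_inf}. chain_below v" and "0 < \<alpha>"
    and x: "bij_betw x {..<n} S" and pos: "\<And>s. s \<in> S \<Longrightarrow> 0 < s" and S: "gcd_closed S"
    and iso: "isomorphic_posets S (dvd) (UNIV :: 'a set) (\<le>)"
  shows "det (power_lcm_matrix \<alpha> n x) \<noteq> 0"
proof -
  obtain \<phi> :: "nat \<Rightarrow> 'a" where \<phi>: "bij_betw \<phi> S UNIV"
    and ord: "\<And>s t. s \<in> S \<Longrightarrow> t \<in> S \<Longrightarrow> s dvd t \<longleftrightarrow> \<phi> s \<le> \<phi> t"
    using iso unfolding isomorphic_posets_def by auto
  define X where "X = inv_into S \<phi>"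
  have XS: "X a \<in> S" and \<phi>X: "\<phi> (X a) = a" for a
    using \<phi> by (auto simp: X_def bij_betw_def inv_into_into f_inv_into_f)
  have dvd: "X a dvd X b \<longleftrightarrow> a \<le> b" for a b
    using ord[OF XS XS] \<phi>X by simp
  have gcd: "gcd (X a) (X b) = X (inf a b)" for a b
  proof (rule gcd_unique_nat[THEN iffD1, symmetric], intro conjI allI impI)
    fix t assume "t dvd X a \<and> t dvd X b"
    then have t: "t dvd gcd (X a) (X b)" by simp
    \<comment> \<open>Here gcd closedness enters: only for a gcd inside \<open>S\<close> can the
      order isomorphism compare it with the meet.\<close>
    have g: "gcd (X a) (X b) \<in> S" using S XS by (auto simp: gcd_closed_def)
    have "\<phi> (gcd (X a) (X b)) \<le> inf a b"
      using ord[OF g XS[of a]] ord[OF g XS[of b]] \<phi>X by simp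
    then have "gcd (X a) (X b) dvd X (inf a b)" using ord[OF g XS] \<phi>X by simp
    then show "t dvd X (inf a b)" using t by (rule dvd_trans[rotated])
  qed (simp_all add: dvd)
  have e: "bij_betw (\<phi> \<circ> x) {..<n} UNIV" using x \<phi> by (rule bij_betw_trans)
  have "power_lcm_matrix \<alpha> n x = power_lcm_matrix \<alpha> n (\<lambda>i. X ((\<phi> \<circ> x) i))"
    unfolding power_lcm_matrix_def
    by (intro cong_mat) (use x \<phi> in \<open>auto simp: X_def bij_betw_def inv_into_f_f\<close>)
  moreover have "moebius_transform (\<lambda>a. real (X a) powr - \<alpha>) v \<noteq> 0" for v
  proof (rule moebius_transform_neq_0[OF chain])
    fix a b :: 'a assume "a < b"
    then have "X a dvd X b" "X a \<noteq> X b" using dvd[of a b] dvd[of b a] by (auto simp: less_le_not_le)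
    then have "X a < X b" using pos[OF XS[of b]] by (simp add: dvd_imp_le le_neq_implies_less)
    then show "real (X b) powr - \<alpha> < real (X a) powr - \<alpha>"
      using pos[OF XS[of a]] \<open>0 < \<alpha>\<close> by (intro powr_less_mono2_neg) auto
  next
    show "0 < real (X a) powr - \<alpha>" for a using pos[OF XS[of a]] by simp
  qed
  ultimately show ?thesis
    using det_power_lcm_matrix[OF pos[OF XS] gcd e] by simp
qed

section \<open>Singular power LCM matrices\<close>

lemma ex_prime_assignment:
  obtains p :: "'a::finite \<Rightarrow> nat" where "inj p" "\<And>a. prime (p a)"
proof -
  obtain B :: "nat set" where B: "finite B" "card B = card (UNIV :: 'a set)" "B \<subseteq> {p. prime p}"
    using infinite_arbitrarily_large[OF primes_infinite] by blast
  obtain p where "bij_betw p (UNIV :: 'a set) B"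
    using finite_same_card_bij[of "UNIV :: 'a set" B] B by auto
  then show thesis using B(3) by (intro that[of p]) (auto simp: bij_betw_def)
qed

text \<open>After splitting off the primes indexed below \<open>inf a b\<close>, the remaining index
  sets are disjoint, so distinctness of the primes makes the cofactors coprime.\<close>

lemma gcd_prod_atMost:
  fixes p :: "'a::{finite, semilattice_inf} \<Rightarrow> nat"
  assumes "inj p" "\<And>a. prime (p a)"
  shows "gcd (prod p {..a}) (prod p {..b}) = prod p {..inf a b}"
proof -
  have split: "prod p {..a} = prod p {..inf a b} * prod p ({..a} - {..inf a b})" for a b
    by (subst prod.subset_diff[of "{..inf a b}" "{..a}"]) (auto simp: mult.commute)
  have "coprime (prod p ({..a} - {..inf a b})) (prod p ({..b} - {..inf a b}))"
    using assms by (intro prod_coprime_left prod_coprime_right primes_coprime) (auto dest: injD)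
  then show ?thesis
    using split[of a b] split[of b a] by (simp add: inf_commute gcd_mult_distrib_nat[symmetric])
qed

text \<open>
  For \<open>\<alpha> = 1\<close> the transform is positive, while its derivative at \<open>\<alpha> = 0\<close>,
  where it vanishes, is \<open>- ln (p v)\<close>.
\<close>

lemma ex_moebius_transform_eq_0:
  fixes v c d :: "'a::{finite, semilattice_inf}" and p :: "'a \<Rightarrow> nat"
  assumes below: "\<And>w. w < v \<Longrightarrow> chain_below w"
    and cd: "covers_in UNIV v c" "covers_in UNIV v d" "c \<noteq> d"
    and p: "\<And>a. 2 \<le> p a"
  shows "\<exists>\<alpha>>0. moebius_transform (\<lambda>a. real (prod p {..a}) powr - \<alpha>) v = 0"
proof -
  define X where "X a = prod p {..a}" for a
  define h where "h \<alpha> = moebius_transform (\<lambda>a. real (X a) powr - \<alpha>) v" for \<alpha>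
  have p0: "0 < p a" for a using p[of a] by simp
  have X0: "0 < X a" for a unfolding X_def using p0 by (intro prod_pos) auto
  \<comment> \<open>Going up from \<open>a\<close> to \<open>b\<close> gains at least the prime
    \<open>p b\<close>; the factor 2 is what the bound on the reciprocals at \<open>c\<close> and
    \<open>d\<close> needs.\<close>
  have X2: "2 * X a \<le> X b" if "a < b" for a b
  proof -
    have "X b = p b * prod p {..<b}"
    proof -
      have "{..b} = insert b {..<b}" by auto
      then show ?thesis by (simp add: X_def)
    qed
    moreover have "X a dvd prod p {..<b}"
      unfolding X_def using that by (intro prod_dvd_prod_subset) (auto intro: order_le_less_trans)
    then have "X a \<le> prod p {..<b}" using p0 by (intro dvd_imp_le prod_pos) auto
    ultimately show ?thesis using p[of b] by (simp add: mult_le_mono)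
  qed
  have less: "c < v" "d < v" using cd by (auto simp: covers_in_def)
  have meet: "inf c d < c" "inf c d < d" using cd by (rule inf_less_covers)+
  have h1: "0 < h 1"
  proof -
    let ?f = "\<lambda>a. real (X a) powr - 1"
    have f: "?f a = 1 / real (X a)" for a using X0[of a] by (simp add: powr_minus_divide)
    have "sum (moebius_transform ?f) {..<v}
        \<le> sum (moebius_transform ?f) {..c} + sum (moebius_transform ?f) {..d} - sum (moebius_transform ?f) {..inf c d}"
    proof (rule sum_lessThan_le[OF less])
      fix w assume w: "w < v" "\<not> w \<le> c"
      \<comment> \<open>Not being below \<open>c\<close>, the element \<open>w\<close> is not the
        bottom, so it has a lower cover.\<close>
      then have "inf w c < w" by (metis inf.cobounded1 inf.cobounded2 le_neq_trans)
      then obtain b where b: "covers_in UNIV w b" using ex_lower_cover by blast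
      then have "X b \<le> X w" using X2[of b w] by (auto simp: covers_in_def)
      then have "?f w \<le> ?f b" unfolding f using X0[of b] by (simp add: frac_le)
      then show "moebius_transform ?f w \<le> 0"
        using moebius_transform_cover[OF below[OF w(1)] b, of ?f] by simp
    qed
    also have "\<dots> = ?f c + ?f d - ?f (inf c d)" by (simp only: sum_atMost_moebius_transform)
    also have "\<dots> \<le> 0"
    proof -
      \<comment> \<open>Each of the reciprocals at \<open>c\<close> and \<open>d\<close> is at most
        half of the one at \<open>inf c d\<close>, so together they do not exceed it.\<close>
      have "?f e \<le> ?f (inf c d) / 2" if "inf c d < e" for e
      proof -
        have "2 * real (X (inf c d)) \<le> real (X e)" using X2[OF that] by linarith
        then have "1 / real (X e) \<le> 1 / (2 * real (X (inf c d)))"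
          using X0[of "inf c d"] by (intro frac_le) auto
        then show ?thesis unfolding f by simp
      qed
      from this[OF meet(1)] this[OF meet(2)] show ?thesis by simp
    qed
    finally show ?thesis
      unfolding h_def moebius_transform_eq_diff[of _ v] f using X0[of v]
      by (simp add: order_le_less_trans)
  qed
  have deriv: "(h has_real_derivative (\<Sum>u\<in>UNIV. real_of_int (moebius u v) * (- ln (real (X u)) * real (X u) powr - \<alpha>))) (at \<alpha>)" for \<alpha>
    unfolding h_def moebius_transform_def
    by (intro DERIV_sum DERIV_cmult) (use X0 in \<open>auto intro!: derivative_eq_intros simp: less_imp_neq[symmetric]\<close>)
  obtain b :: 'a where b: "\<And>x. b \<le> x" using finite_semilattice_inf_bot by blast
  \<comment> \<open>For exponent 0 the function is constantly 1, the ideal sum of the indicator of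
    the bottom \<open>b\<close>; its transform vanishes at \<open>v\<close>, which is not the
    bottom.\<close>
  have h0: "h 0 = 0"
  proof -
    have "(\<lambda>a. real (X a) powr - 0) = (\<lambda>u. \<Sum>w\<in>{..u}. of_bool (w = b))"
      using X0 b by (simp add: less_imp_neq[symmetric] of_bool_def)
    then have "h 0 = of_bool (v = b)"
      using moebius_transform_sum_atMost[of "\<lambda>w. of_bool (w = b)" v] by (simp only: h_def)
    then show ?thesis using less(1) b[of c] by auto
  qed
  have "(\<Sum>u\<in>UNIV. real_of_int (moebius u v) * (- ln (real (X u)) * real (X u) powr - 0)) = - ln (real (p v))"
  proof -
    \<comment> \<open>The logarithm turns the product defining \<open>X u\<close> into an ideal sum,
      so inversion leaves only the term at \<open>v\<close>.\<close>
    have "- ln (real (X u)) = (\<Sum>w\<in>{..u}. - ln (real (p w)))" for u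
      unfolding X_def of_nat_prod using p0 by (subst ln_prod) (auto simp: sum_negf)
    then show ?thesis
      using moebius_transform_sum_atMost[of "\<lambda>w. - ln (real (p w))" v] X0
      by (simp add: moebius_transform_def less_imp_neq[symmetric])
  qed
  then have "(h has_real_derivative - ln (real (p v))) (at 0)" using deriv[of 0] by simp
  moreover have "- ln (real (p v)) < 0" using p[of v] by simp
  ultimately obtain \<delta> where \<delta>: "0 < \<delta>" "\<And>t. 0 < t \<Longrightarrow> t < \<delta> \<Longrightarrow> h (0 + t) < h 0"
    using DERIV_neg_dec_right[of h "- ln (real (p v))" 0] by auto
  \<comment> \<open>The interval for the intermediate value theorem starts at a point with
    \<open>h\<close> negative, since starting at 0 would admit the useless root 0.\<close>
  define \<epsilon> where "\<epsilon> = min (\<delta> / 2) (1 / 2)"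
  have \<epsilon>: "0 < \<epsilon>" "\<epsilon> < 1" "h \<epsilon> < 0" using \<delta>(1) \<delta>(2)[of \<epsilon>] h0 by (auto simp: \<epsilon>_def)
  have "continuous_on {\<epsilon>..1} h"
    using deriv by (intro continuous_at_imp_continuous_on ballI DERIV_isCont) blast
  then obtain \<alpha> where "\<epsilon> \<le> \<alpha>" "h \<alpha> = 0"
    using IVT'[of h \<epsilon> 0 1] \<epsilon> h1 by auto
  then show ?thesis using \<epsilon> unfolding h_def X_def by (intro exI[of _ \<alpha>]) auto
qed

lemma ex_singular_power_lcm_matrix:
  assumes "\<not> chain_below (z :: 'a::{finite, semilattice_inf})" "card (UNIV :: 'a set) = n"
  shows "\<exists>\<alpha>>0. \<exists>S x. bij_betw x {..<n} S \<and> (\<forall>s\<in>S. 0 < s) \<and> gcd_closed S \<and>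
    isomorphic_posets S (dvd) (UNIV :: 'a set) (\<le>) \<and> det (power_lcm_matrix \<alpha> n x) = 0"
proof -
  obtain v c d :: 'a where vcd: "\<And>w. w < v \<Longrightarrow> chain_below w"
      "covers_in UNIV v c" "covers_in UNIV v d" "c \<noteq> d"
    using minimal_non_chain[OF assms(1)] by blast
  obtain p :: "'a \<Rightarrow> nat" where p: "inj p" "\<And>a. prime (p a)" using ex_prime_assignment by blast
  define X where "X a = prod p {..a}" for a
  obtain \<alpha> where \<alpha>: "0 < \<alpha>" "moebius_transform (\<lambda>a. real (X a) powr - \<alpha>) v = 0"
    using ex_moebius_transform_eq_0[OF vcd, of p] p(2) by (auto simp: X_def prime_ge_2_nat)
  have pos: "0 < X a" for a unfolding X_def using p(2) by (intro prod_pos) (auto simp: prime_gt_0_nat)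
  have gcd: "gcd (X a) (X b) = X (inf a b)" for a b unfolding X_def using p by (rule gcd_prod_atMost)
  \<comment> \<open>The prime \<open>p a\<close> marks \<open>a\<close>: it divides
    \<open>X b\<close> only when \<open>a\<close> is among the indices below
    \<open>b\<close>.\<close>
  have dvd: "X a dvd X b \<longleftrightarrow> a \<le> b" for a b
  proof
    assume "X a dvd X b"
    moreover have "p a dvd X a" unfolding X_def by (intro dvd_prodI) auto
    ultimately have "p a dvd prod p {..b}" unfolding X_def by (rule dvd_trans[rotated])
    then obtain w where "w \<le> b" "p a dvd p w" using p(2)[of a] by (auto simp: prime_dvd_prod_iff)
    then show "a \<le> b" using p by (metis injD primes_dvd_imp_eq)
  next
    assume "a \<le> b"
    then show "X a dvd X b" unfolding X_def by (intro prod_dvd_prod_subset) auto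
  qed
  have inj: "inj X" using dvd by (metis antisym dvd_refl injI)
  obtain e where e: "bij_betw e {..<n} (UNIV :: 'a set)"
    using finite_same_card_bij[of "{..<n}" "UNIV :: 'a set"] assms(2) by auto
  have "isomorphic_posets (range X) (dvd) (UNIV :: 'a set) (\<le>)"
    unfolding isomorphic_posets_def
    by (intro exI[of _ "inv_into UNIV X"]) (auto simp: inj dvd inj_imp_bij_betw_inv)
  moreover have "bij_betw (\<lambda>i. X (e i)) {..<n} (range X)"
    using bij_betw_trans[OF e inj_on_imp_bij_betw[OF inj]] by (simp add: comp_def)
  moreover have "gcd_closed (range X)" by (auto simp: gcd_closed_def gcd)
  moreover have "det (power_lcm_matrix \<alpha> n (\<lambda>i. X (e i))) = 0"
    using det_power_lcm_matrix[OF pos gcd e] \<alpha>(2) by blast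
  ultimately show ?thesis using \<alpha>(1) pos by blast
qed

theorem theorem5p2:
  fixes n :: nat
  assumes "card (UNIV :: 'a::{finite, semilattice_inf} set) = n"
  shows
    "((\<forall>\<alpha>::real. \<alpha> > 0 \<longrightarrow>
        (\<forall>(S :: nat set) (x :: nat \<Rightarrow> nat).
           bij_betw x {..<n} S \<and> (\<forall>s\<in>S. 0 < s) \<and> gcd_closed S \<and>
           isomorphic_posets S (dvd) (UNIV :: 'a set) (\<le>) \<longrightarrow>
           det (power_lcm_matrix \<alpha> n x) \<noteq> 0))
      \<longleftrightarrow> wedge_tree_set (UNIV :: 'a set))
     \<and>
     (wedge_tree_set (UNIV :: 'a set)
      \<longleftrightarrow> (\<forall>z z' :: 'a. moebius z z' > 0 \<longrightarrow> z = z'))"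
  (is "(?nonsingular \<longleftrightarrow> _) \<and> _")
proof -
  have "?nonsingular \<longleftrightarrow> (\<forall>v::'a. chain_below v)"
    using power_lcm_matrix_nonsingular[where 'a = 'a] ex_singular_power_lcm_matrix[OF _ assms]
    by blast
  then show ?thesis unfolding wedge_tree_set_UNIV_iff chain_below_iff_moebius by blast
qed

end
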